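(* Let $1\le d\le n$ be integers. If $A=(A_0,\dots,A_n)$ is a feasible solution to the $(n,d)$ Delsarte linear program, then its extension $A'=(A'_0,\dots,A'_{n+1})$ is a feasible solution to the $(n+1,2\lceil d/2\rceil)$ Delsarte linear program.
   Context: $[a]=\{1,\dots,a\}$ (empty if $a\le 0$). $\binom{a}{b}=0$ unless $0\le b\le a$. For a block length $m$ and $0\le i,j\le m$, the Krawtchouk polynomial is $K_j(i;m)=\sum_{k=0}^j(-1)^k\binom{i}{k}\binom{m-i}{j-k}$. For integers $1\le d\le m$, the $(m,d)$ Delsarte linear program, in real variables $A=(A_0,\dots,A_m)$, is: maximize $\sum_{i=0}^m A_i$ subject to $\sum_{i=0}^m A_iK_j(i;m)\ge 0$ for all $j\in[m]$; $A_i=0$ for all $i\in[d-1]$; $A_0=1$; $A_i\ge 0$ for all $i\in[m]$. A feasible solution is a vector satisfying all of these constraints. The extension of $A=(A_0,\dots,A_n)$ is the vector $A'=(A'_0,\dots,A'_{n+1})$ given by $A'_i=0$ for all odd $i$ and $A'_i=A_i+A_{i-1}$ for all even $i$, for $0\le i\le n+1$, where $A_{-1}=A_{n+1}=0$. *)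

theory Defs
  imports Complex_Main
begin

text \<open>A vector indexed by 0, ..., m is a function \<^typ>\<open>nat \<Rightarrow> real\<close> of which
  only the values at arguments up to m are meaningful; values beyond m are never used.\<close>

text \<open>Used only for i, j at most m, so that the subtractions on \<^typ>\<open>nat\<close> do not truncate.\<close>

definition krawtchouk :: "nat \<Rightarrow> nat \<Rightarrow> nat \<Rightarrow> real" where
  "krawtchouk m j i =
     (\<Sum>k=0..j. (- 1) ^ k * real (i choose k) * real ((m - i) choose (j - k)))"

text \<open>The constraints of the (m, d) Delsarte linear program, meant for d between 1 and m.
  The objective, maximizing the sum of all A i, plays no role in feasibility.\<close>

definition delsarte_feasible :: "nat \<Rightarrow> nat \<Rightarrow> (nat \<Rightarrow> real) \<Rightarrow> bool" where
  "delsarte_feasible m d A \<longleftrightarrow>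
     (\<forall>j\<in>{1..m}. (\<Sum>i=0..m. A i * krawtchouk m j i) \<ge> 0) \<and>
     (\<forall>i\<in>{1..d - 1}. A i = 0) \<and>
     A 0 = 1 \<and>
     (\<forall>i\<in>{1..m}. A i \<ge> 0)"

text \<open>The two guards encode the convention that the entries of A at -1 and n + 1 are 0.\<close>

definition extension :: "nat \<Rightarrow> (nat \<Rightarrow> real) \<Rightarrow> nat \<Rightarrow> real" where
  "extension n A i =
     (if odd i then 0
      else (if i \<le> n then A i else 0) + (if 1 \<le> i \<and> i \<le> n + 1 then A (i - 1) else 0))"

end

theory Submission
  imports Defs "HOL-Computational_Algebra.Polynomial"
begin

text \<open>
  On the level of codes the extension adds a parity bit: the weight \<open>i\<close> of a word becomes the least
  even number \<open>e i \<ge> i\<close> (\<open>round_up_even\<close> below).  Hence the dual constraint of the extension with index \<open>j\<close> is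
  \<open>\<Sum>i\<le>n. A i * krawtchouk (n + 1) j (e i)\<close> (lemma \<open>sum_extension\<close>), and the task is to express
  these Krawtchouk values for length \<open>n + 1\<close> by those for length \<open>n\<close>.

  The values \<open>krawtchouk m j i\<close> are the coefficients of \<open>(1 - x)\<^sup>i (1 + x)\<^sup>m\<^sup>-\<^sup>i\<close>.  Passing from \<open>(n, i)\<close>
  to \<open>(n + 1, e i)\<close> multiplies this polynomial by \<open>1 + x\<close> if \<open>i\<close> is even and by \<open>1 - x\<close> if \<open>i\<close> is
  odd, that is, by \<open>1 + (-1)\<^sup>i x\<close>.  On the other hand, reversing the order of the coefficients
  multiplies the polynomial by \<open>(-1)\<^sup>i\<close>.  The two signs cancel, which gives
  \<open>krawtchouk (n + 1) j (e i) = krawtchouk n j i + krawtchouk n (n + 1 - j) i\<close> for \<open>1 \<le> j \<le> n + 1\<close>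
  (lemma \<open>krawtchouk_Suc_round_up_even\<close>).  So every dual sum of the extension is a sum of two dual
  sums of \<open>A\<close>, with indices \<open>j\<close> and \<open>n + 1 - j\<close>.  For \<open>j \<le> n\<close> both are nonnegative by feasibility;
  for \<open>j = n + 1\<close> they are \<open>0\<close> and the sum of all entries of \<open>A\<close>.
\<close>

definition krawtchouk_poly :: "nat \<Rightarrow> nat \<Rightarrow> real poly" where
  "krawtchouk_poly m i = [:1, - 1:] ^ i * [:1, 1:] ^ (m - i)"

lemma coeff_one_plus_linear_power: "coeff ([:1, c:] ^ n) k = real (n choose k) * c ^ k"
proof (cases "k \<le> n")
  case True
  then show ?thesis by (simp add: coeff_linear_poly_power)
next
  case False
  have "degree ([:1, c:] ^ n) \<le> degree [:1, c:] * n"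
    by (rule degree_power_le)
  also have "\<dots> \<le> n" by simp
  finally show ?thesis
    using False by (simp add: coeff_eq_0 binomial_eq_0)
qed

lemma krawtchouk_eq_coeff: "krawtchouk m j i = coeff (krawtchouk_poly m i) j"
proof -
  have "coeff (krawtchouk_poly m i) j =
      (\<Sum>k\<le>j. (real (i choose k) * (- 1) ^ k) * real ((m - i) choose (j - k)))"
    unfolding krawtchouk_poly_def coeff_mult coeff_one_plus_linear_power by simp
  then show ?thesis
    by (simp add: krawtchouk_def atMost_atLeast0 mult_ac)
qed

lemma degree_krawtchouk_poly:
  assumes "i \<le> m"
  shows "degree (krawtchouk_poly m i) = m"
  using assms unfolding krawtchouk_poly_def
  by (simp add: degree_mult_eq degree_power_eq)

text \<open>The factors \<open>1 + x\<close> are palindromic, and each of the \<open>i\<close> factors \<open>1 - x\<close> changes sign.\<close>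

lemma reflect_krawtchouk_poly:
  "reflect_poly (krawtchouk_poly m i) = smult ((- 1) ^ i) (krawtchouk_poly m i)"
proof -
  have minus: "reflect_poly [:1, - 1 :: real:] = smult (- 1) [:1, - 1:]"
    by (simp add: reflect_poly_def)
  have plus: "reflect_poly [:1, 1 :: real:] = [:1, 1:]"
    by (simp add: reflect_poly_def)
  show ?thesis
    unfolding krawtchouk_poly_def reflect_poly_mult reflect_poly_power minus plus smult_power
    by (simp only: mult_smult_left)
qed

lemma krawtchouk_reflect:
  assumes "i \<le> m" and "j \<le> m"
  shows "krawtchouk m (m - j) i = (- 1) ^ i * krawtchouk m j i"
proof -
  have "krawtchouk m (m - j) i = coeff (reflect_poly (krawtchouk_poly m i)) j"
    using assms by (simp add: krawtchouk_eq_coeff coeff_reflect_poly degree_krawtchouk_poly)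
  then show ?thesis
    by (simp add: reflect_krawtchouk_poly krawtchouk_eq_coeff)
qed

lemma krawtchouk_beyond_length:
  assumes "i \<le> m" and "m < j"
  shows "krawtchouk m j i = 0"
  using assms by (simp add: krawtchouk_eq_coeff coeff_eq_0 degree_krawtchouk_poly)

lemma krawtchouk_0: "krawtchouk m 0 i = 1"
  by (simp add: krawtchouk_def)

definition round_up_even :: "nat \<Rightarrow> nat" where
  "round_up_even i = (if even i then i else i + 1)"

lemma krawtchouk_poly_Suc_round_up_even:
  assumes "i \<le> n"
  shows "krawtchouk_poly (n + 1) (round_up_even i) = [:1, (- 1) ^ i:] * krawtchouk_poly n i"
  using assms
  by (cases "even i")
    (simp_all add: krawtchouk_poly_def round_up_even_def Suc_diff_le mult_ac
      del: mult_pCons_left mult_pCons_right)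

text \<open>
  The factor \<open>1 + (-1)\<^sup>i x\<close> yields the term \<open>(-1)\<^sup>i * krawtchouk n (j - 1) i\<close>, whose sign the
  reflection \<open>j - 1 \<mapsto> n - (j - 1)\<close> absorbs.
\<close>

lemma krawtchouk_Suc_round_up_even:
  assumes "i \<le> n" and "1 \<le> j" and "j \<le> n + 1"
  shows "krawtchouk (n + 1) j (round_up_even i) = krawtchouk n j i + krawtchouk n (n + 1 - j) i"
proof -
  obtain l where l: "j = Suc l" "l \<le> n"
    using assms(2,3) by (cases j) auto
  have "krawtchouk (n + 1) j (round_up_even i) = krawtchouk n j i + (- 1) ^ i * krawtchouk n l i"
    unfolding krawtchouk_eq_coeff krawtchouk_poly_Suc_round_up_even [OF assms(1)] l(1)
    by simp
  also have "(- 1) ^ i * krawtchouk n l i = krawtchouk n (n + 1 - j) i"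
    using krawtchouk_reflect [OF assms(1) l(2)] l(1) by simp
  finally show ?thesis .
qed

text \<open>The extension is the image of \<open>A\<close> under rounding the index up to an even number.\<close>

lemma sum_extension:
  "(\<Sum>i=0..n + 1. extension n A i * f i) = (\<Sum>i=0..n. A i * f (round_up_even i))"
proof -
  have "(\<Sum>i=0..n + 1. extension n A i * f i) =
      (\<Sum>i=0..Suc n. if even i \<and> i \<le> n then A i * f i else 0) +
      (\<Sum>i=0..Suc n. if even i \<and> 1 \<le> i then A (i - 1) * f i else 0)"
    unfolding sum.distrib [symmetric] Suc_eq_plus1 [symmetric]
    by (rule sum.cong) (auto simp: extension_def algebra_simps)
  also have "(\<Sum>i=0..Suc n. if even i \<and> i \<le> n then A i * f i else 0) =
      (\<Sum>i=0..n. if even i then A i * f i else 0)"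
    by simp
  also have "(\<Sum>i=0..Suc n. if even i \<and> 1 \<le> i then A (i - 1) * f i else 0) =
      (\<Sum>i=0..n. if odd i then A i * f (i + 1) else 0)"
    unfolding sum.atLeast0_atMost_Suc_shift by (auto intro!: sum.cong)
  finally show ?thesis
    unfolding sum.distrib [symmetric] by (auto intro!: sum.cong simp: round_up_even_def)
qed

theorem proposition5p2:
  fixes n d :: nat and A :: "nat \<Rightarrow> real"
  assumes "1 \<le> d" and "d \<le> n"
    and "delsarte_feasible n d A"
  shows "delsarte_feasible (n + 1) (2 * nat \<lceil>real d / 2\<rceil>) (extension n A)"
proof -
  define S where "S j = (\<Sum>i=0..n. A i * krawtchouk n j i)" for j
  have dual: "S j \<ge> 0" if "j \<in> {1..n}" for j
    using assms(3) that by (auto simp: delsarte_feasible_def S_def)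
  have zero: "A i = 0" if "1 \<le> i" "i < d" for i
    using assms(3) that by (auto simp: delsarte_feasible_def)
  have A0: "A 0 = 1"
    using assms(3) by (simp add: delsarte_feasible_def)
  have nonneg: "A i \<ge> 0" if "i \<le> n" for i
    using assms(3) A0 that by (cases "i = 0") (auto simp: delsarte_feasible_def)
  have S_0: "S 0 \<ge> 0"
    using nonneg by (auto simp: S_def krawtchouk_0 intro!: sum_nonneg)
  have S_Suc: "S (n + 1) = 0"
    by (simp add: S_def krawtchouk_beyond_length)

  have "(\<Sum>i=0..n + 1. extension n A i * krawtchouk (n + 1) j i) \<ge> 0" if j: "j \<in> {1..n + 1}" for j
  proof -
    have "(\<Sum>i=0..n + 1. extension n A i * krawtchouk (n + 1) j i) = S j + S (n + 1 - j)"
      unfolding sum_extension S_def sum.distrib [symmetric]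
      using j by (intro sum.cong refl) (subst krawtchouk_Suc_round_up_even; simp add: distrib_left)
    moreover have "S j + S (n + 1 - j) \<ge> 0"
    proof (cases "j = n + 1")
      case True
      then show ?thesis using S_0 S_Suc by simp
    next
      case False
      with j have "j \<in> {1..n}" "n + 1 - j \<in> {1..n}" by auto
      then show ?thesis using dual by (intro add_nonneg_nonneg) auto
    qed
    ultimately show ?thesis by simp
  qed
  moreover have "extension n A i = 0" if i: "i \<in> {1..2 * nat \<lceil>real d / 2\<rceil> - 1}" for i
  proof (cases "even i")
    case True
    \<comment> \<open>As \<open>i\<close> is even, its bound improves by one, to at most \<open>d - 1\<close>, so that \<open>A\<close> vanishes at both
      \<open>i\<close> and \<open>i - 1\<close>.\<close>
    obtain q where q: "nat \<lceil>real d / 2\<rceil> = q" "2 * q \<le> d + 1"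
      by (rule that [OF refl]) linarith
    from True obtain b where b: "i = 2 * b" by (elim evenE)
    have "i < d" "2 \<le> i"
      using i q(2) unfolding q(1) b atLeastAtMost_iff by presburger+
    then show ?thesis
      using zero [of i] zero [of "i - 1"] by (simp add: extension_def)
  qed (simp add: extension_def)
  moreover have "extension n A 0 = 1"
    by (simp add: extension_def A0)
  moreover have "extension n A i \<ge> 0" for i
    using nonneg by (auto simp: extension_def)
  ultimately show ?thesis
    by (auto simp: delsarte_feasible_def)
qed

end
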